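(* For the significance vector $s=(0,0,1,2,\dotsc,n-1)$ (of length $n+1$, so the function takes an $n$-bit number $\sum_{i=0}^{n-1}2^i x_i$ together with an additional bit $t$ of significance $0$ and outputs the $(n+1)$-bit binary representation of $t+\sum_{i=0}^{n-1}2^ix_i$), the minimum size of a Boolean circuit over the full binary basis computing the corresponding bit adder satisfies $\operatorname{size}(\mathrm{BA}^{0,0,1,\dotsc,n-1}) \ge 2n-O(1)$.
   Context: A Boolean circuit over the full binary basis is a directed acyclic graph whose source nodes are labeled by input variables and the constants $0,1$, and whose other nodes have in-degree $2$ and are labeled by arbitrary binary Boolean operations; some gates are designated as outputs. The size of a circuit is its number of non-input gates, and $\operatorname{size}(f)$ is the minimum size of a circuit computing $f$. For $s\in\mathbb{Z}_{\ge0}^k$, the bit adder $\mathrm{BA}^s$ maps $(x_1,\dotsc,x_k)\in\{0,1\}^k$ to the bits of the binary representation of $\sum_{i=1}^k 2^{s_i}x_i$ (omitting bit positions that are identically zero). *)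

theory Defs
  imports Complex_Main
begin

section \<open>Circuits over the full binary basis\<close>

datatype node_label =
    Var nat
  | Const bool
  | Gate "bool \<Rightarrow> bool \<Rightarrow> bool" nat nat

text \<open>
  The two in-edges of a gate are stored in its label, because the order of the two arguments
  matters; they may come from the same node. Since circuits are finite, it is no restriction that
  nodes are natural numbers. Outputs may be arbitrary nodes, source nodes and repetitions included.
\<close>

record circuit =
  nodes :: "nat set"
  lab :: "nat \<Rightarrow> node_label"
  outs :: "nat list"

definition edges :: "circuit \<Rightarrow> (nat \<times> nat) set" where
  "edges C = {(u, v). v \<in> nodes C \<and> (\<exists>g a b. lab C v = Gate g a b \<and> (u = a \<or> u = b))}"

definition circuit_on :: "nat \<Rightarrow> circuit \<Rightarrow> bool" where
  "circuit_on k C \<longleftrightarrow>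
     finite (nodes C) \<and>
     edges C \<subseteq> nodes C \<times> nodes C \<and>
     acyclic (edges C) \<and>
     (\<forall>v\<in>nodes C. \<forall>i. lab C v = Var i \<longrightarrow> i < k) \<and>
     set (outs C) \<subseteq> nodes C"

inductive node_value :: "circuit \<Rightarrow> bool list \<Rightarrow> nat \<Rightarrow> bool \<Rightarrow> bool" for C x where
  "lab C v = Var i \<Longrightarrow> node_value C x v (x ! i)"
| "lab C v = Const b \<Longrightarrow> node_value C x v b"
| "lab C v = Gate g u w \<Longrightarrow> node_value C x u a \<Longrightarrow> node_value C x w b
     \<Longrightarrow> node_value C x v (g a b)"

lemma node_value_unique:
  "node_value C x v a \<Longrightarrow> node_value C x v b \<Longrightarrow> a = b"
proof (induction arbitrary: b rule: node_value.induct)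
  case (1 v i)
  from 1(2) show ?case by (cases rule: node_value.cases) (simp_all add: 1(1))
next
  case (2 v c)
  from 2(2) show ?case by (cases rule: node_value.cases) (simp_all add: 2(1))
next
  case (3 v g u w a c)
  from 3(6) show ?case
    by (cases rule: node_value.cases) (auto simp: 3(1) dest: 3(4) 3(5))
qed

lemma node_value_exists:
  assumes "circuit_on k C" and "v \<in> nodes C"
  shows "\<exists>b. node_value C x v b"
proof -
  have "finite (edges C)"
    using assms(1) unfolding circuit_on_def by (meson finite_SigmaI finite_subset)
  then have "wf (edges C)"
    using assms(1) unfolding circuit_on_def by (blast intro: finite_acyclic_wf)
  then show ?thesis
    using assms(2)
  proof (induction v rule: wf_induct_rule)
    case (less v)
    show ?case
    proof (cases "lab C v")
      case (Gate g u w)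
      then have e: "(u, v) \<in> edges C" "(w, v) \<in> edges C"
        using less.prems by (auto simp: edges_def)
      then have "u \<in> nodes C" "w \<in> nodes C"
        using assms(1) unfolding circuit_on_def by auto
      then show ?thesis
        using less.IH e Gate node_value.intros(3) by metis
    qed (auto intro: node_value.intros)
  qed
qed

definition computes :: "nat \<Rightarrow> circuit \<Rightarrow> (bool list \<Rightarrow> bool list) \<Rightarrow> bool" where
  "computes k C f \<longleftrightarrow>
     (\<forall>x. length x = k \<longrightarrow> list_all2 (node_value C x) (outs C) (f x))"

definition gate_count :: "circuit \<Rightarrow> nat" where
  "gate_count C = card {v \<in> nodes C. \<exists>g a b. lab C v = Gate g a b}"

text \<open>
  The function \<open>f\<close> is only considered on inputs of length \<open>k\<close>. The minimum exists
  whenever the outputs of \<open>f\<close> on these inputs all have the same length.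
\<close>

definition circuit_size :: "nat \<Rightarrow> (bool list \<Rightarrow> bool list) \<Rightarrow> nat" where
  "circuit_size k f = (LEAST m. \<exists>C. circuit_on k C \<and> computes k C f \<and> gate_count C = m)"


section \<open>Bit adders\<close>

definition weighted_sum :: "nat list \<Rightarrow> bool list \<Rightarrow> nat" where
  "weighted_sum s x = (\<Sum>i<length s. 2 ^ (s ! i) * of_bool (x ! i))"

definition bit_positions :: "nat list \<Rightarrow> nat set" where
  "bit_positions s = {j. \<exists>x. length x = length s \<and> bit (weighted_sum s x) j}"

text \<open>Output bits are listed from the least to the most significant one.\<close>

definition bit_adder :: "nat list \<Rightarrow> bool list \<Rightarrow> bool list" where
  "bit_adder s x = map (bit (weighted_sum s x)) (sorted_list_of_set (bit_positions s))"

lemma finite_bit_positions: "finite (bit_positions s)"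
proof (rule finite_subset)
  let ?M = "\<Sum>i<length s. 2 ^ (s ! i) :: nat"
  show "bit_positions s \<subseteq> {..?M}"
  proof
    fix j assume "j \<in> bit_positions s"
    then obtain x where b: "bit (weighted_sum s x) j"
      by (auto simp: bit_positions_def)
    have "j < 2 ^ j" by (rule less_exp)
    also have "2 ^ j \<le> weighted_sum s x"
      using b by (metis bit_iff_odd div_less even_zero leI)
    also have "\<dots> \<le> ?M"
      unfolding weighted_sum_def by (rule sum_mono) auto
    finally show "j \<in> {..?M}" by simp
  qed
qed simp

end

theory Submission
  imports Defs
begin

text \<open>
  Call two Boolean functions equivalent if they agree up to complement, and count the classes
  of functions computed in the circuit other than constants and literals. Fix the most significant
  input \<open>x\<close> to \<open>0\<close>. With \<open>c\<close> the carry arriving at \<open>x\<close>, the top output \<open>x \<and> c\<close>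
  becomes constant, so at least one class is lost. A gate fed by \<open>x\<close> becomes a constant or its
  other argument up to complement. So if no other class were lost or merged, it would already have
  been equivalent to a constant, a literal, \<open>x \<and> c\<close> or its other argument. Inductively, no
  node function except the literal \<open>x\<close> would depend on \<open>x\<close> when \<open>c = 0\<close>,
  contradicting the output \<open>x \<oplus> c\<close>. So every step loses two classes, and the restricted
  circuit contains the adder with one bit less.
\<close>

section \<open>Families of normalized functions\<close>

text \<open>
  Classes up to complement are represented by their members that vanish at the all-\<open>False\<close>
  assignment, a choice that is compatible with fixing a variable to \<open>False\<close>.
\<close>

type_synonym boolfun = "(nat \<Rightarrow> bool) \<Rightarrow> bool"

definition degenerate :: "boolfun set" where
  "degenerate = insert (\<lambda>_. False) (range (\<lambda>j a. a j))"

text \<open>This abstracts a circuit to the set \<open>T\<close> of functions at its nodes: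
  \<open>T \<subseteq> generated T\<close> says that every member arises from degenerate functions
  by gates without leaving \<open>T\<close>. The condition on \<open>h\<close> keeps functions
  normalized. Unlike a circuit, such a set needs no surgery when a variable is fixed.\<close>

inductive_set generated :: "boolfun set \<Rightarrow> boolfun set" for T where
  degenerate: "f \<in> degenerate \<Longrightarrow> f \<in> generated T"
| gate: "f \<in> generated T \<Longrightarrow> f' \<in> generated T \<Longrightarrow> h False False = False \<Longrightarrow>
    (\<lambda>a. h (f a) (f' a)) \<in> T \<Longrightarrow> (\<lambda>a. h (f a) (f' a)) \<in> generated T"

definition restrict0 :: "nat \<Rightarrow> boolfun \<Rightarrow> boolfun" where
  "restrict0 m f = (\<lambda>a. f (a(m := False)))"

text \<open>Variable \<open>0\<close> is the additional bit and variable \<open>Suc i\<close> is bit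
  \<open>i\<close> of the number, so this conjunction is the carry arriving at variable
  \<open>m\<close>.\<close>

definition carry :: "nat \<Rightarrow> boolfun" where
  "carry m a \<longleftrightarrow> (\<forall>j<m. a j)"

definition sum_bit :: "nat \<Rightarrow> boolfun" where
  "sum_bit m a \<longleftrightarrow> (a m \<noteq> carry m a)"

lemma carry_Suc: "carry (Suc m) a \<longleftrightarrow> carry m a \<and> a m"
  by (auto simp: carry_def less_Suc_eq)

lemma restrict0_degenerate: "f \<in> degenerate \<Longrightarrow> restrict0 m f \<in> degenerate"
proof -
  assume "f \<in> degenerate"
  then consider "f = (\<lambda>_. False)" | j where "f = (\<lambda>a. a j)"
    by (auto simp: degenerate_def)
  then show ?thesis
  proof cases
    case 1
    then show ?thesis by (simp add: restrict0_def degenerate_def)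
  next
    case (2 j)
    then show ?thesis by (cases "j = m") (auto simp: restrict0_def degenerate_def)
  qed
qed

lemma degenerate_insensitive:
  "f \<in> degenerate \<Longrightarrow> f = (\<lambda>a. a m) \<or> (\<forall>a. f a = f (a(m := b)))"
proof -
  assume "f \<in> degenerate"
  then consider "f = (\<lambda>_. False)" | j where "f = (\<lambda>a. a j)"
    by (auto simp: degenerate_def)
  then show ?thesis by cases (auto simp: fun_upd_def)
qed

lemma generated_cases: "f \<in> generated T \<Longrightarrow> f \<in> degenerate \<or> f \<in> T"
  by (induction rule: generated.induct) auto

lemma generated_restrict0:
  assumes "f \<in> generated T"
  shows "restrict0 m f \<in> generated (restrict0 m ` T)"
  using assms
proof induction
  case (degenerate f)
  then show ?case by (intro generated.degenerate restrict0_degenerate)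
next
  case (gate f f' h)
  have eq: "restrict0 m (\<lambda>a. h (f a) (f' a)) = (\<lambda>a. h (restrict0 m f a) (restrict0 m f' a))"
    by (simp add: restrict0_def)
  have "restrict0 m (\<lambda>a. h (f a) (f' a)) \<in> restrict0 m ` T"
    using gate.hyps(4) by (rule imageI)
  then show ?case
    unfolding eq by (rule generated.gate[where h = h, OF gate.IH gate.hyps(3)])
qed

text \<open>The hypothesis excludes \<open>m = 0\<close>, where the carry is the literal
  \<open>a 0\<close>.\<close>

lemma carry_Suc_not_degenerate:
  assumes "m \<ge> 1"
  shows "carry (Suc m) \<notin> degenerate"
proof
  assume "carry (Suc m) \<in> degenerate"
  then consider "carry (Suc m) = (\<lambda>_. False)" | j where "carry (Suc m) = (\<lambda>a. a j)"
    by (auto simp: degenerate_def)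
  then show False
  proof cases
    case 1
    from fun_cong[OF this, of "\<lambda>_. True"] show False by (simp add: carry_def)
  next
    case 2
    from fun_cong[OF 2, of "\<lambda>i. i = j"] have "\<forall>i<Suc m. i = j" by (simp add: carry_def)
    then have "0 = j" "m = j" by blast+
    with assms show False by simp
  qed
qed

text \<open>The first two assumptions say that fixing variable \<open>m\<close> to
  \<open>False\<close> loses no class besides \<open>carry (Suc m)\<close>. Then a gate reading
  variable \<open>m\<close> yields nothing new: its output is degenerate, is that carry, or equals
  its other argument.\<close>

lemma gate_on_variable_insensitive:
  assumes inj: "inj_on (restrict0 m) (T - degenerate - {carry (Suc m)})"
    and nd: "\<And>f. f \<in> T - degenerate - {carry (Suc m)} \<Longrightarrow> restrict0 m f \<notin> degenerate"
    and f: "f \<in> generated T" and h: "h False False = False"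
    and T: "(\<lambda>a. h (a m) (f a)) \<in> T"
  defines "G \<equiv> \<lambda>a. h (a m) (f a)"
  assumes inv: "f = (\<lambda>a. a m) \<or> (\<forall>a. \<not> carry m a \<longrightarrow> f a = f (a(m := False)))"
  shows "G = (\<lambda>a. a m) \<or> (\<forall>a. \<not> carry m a \<longrightarrow> G a = G (a(m := False)))"
proof -
  have car: "carry (Suc m) (a(m := False)) = False" for a
    by (auto simp: carry_def)
  consider "G \<in> degenerate" | "G = carry (Suc m)" | "G \<in> T - degenerate - {carry (Suc m)}"
    using T by (auto simp: G_def)
  then show ?thesis
  proof cases
    case 1
    then show ?thesis using degenerate_insensitive[OF 1, of m False] by blast
  next
    case 2
    then show ?thesis by (auto simp: carry_Suc)
  next
    case 3
    from nd[OF 3] have rG: "restrict0 m G \<notin> degenerate" .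
    \<comment> \<open>Otherwise fixing the variable would make \<open>G\<close> constant. Hence
      \<open>h False\<close> is the identity.\<close>
    have "h False True"
    proof (rule ccontr)
      assume "\<not> h False True"
      then have "h False b = False" for b using h by (cases b) auto
      then have "restrict0 m G = (\<lambda>_. False)"
        by (simp add: restrict0_def G_def)
      with rG show False by (simp add: degenerate_def)
    qed
    then have "h False b = b" for b using h by (cases b) auto
    then have eq: "restrict0 m G = restrict0 m f"
      by (simp add: restrict0_def G_def)
    have "f \<notin> degenerate" using eq rG restrict0_degenerate by metis
    moreover from this have "f \<in> T" using generated_cases[OF f] by simp
    \<comment> \<open>That carry restricts to a constant, whereas \<open>f\<close> restricts to the
      same nondegenerate function as \<open>G\<close>.\<close>
    moreover have "f \<noteq> carry (Suc m)"
      using eq rG car by (auto simp: restrict0_def degenerate_def)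
    ultimately have "f = G"
      using inj_onD[OF inj, OF eq[symmetric]] 3 by simp
    then show ?thesis using inv by simp
  qed
qed

lemma card_restrict0:
  assumes fin: "finite T" and gen: "T \<subseteq> generated T" and m: "m \<ge> 1"
    and c: "carry (Suc m) \<in> T" and s: "sum_bit m \<in> T"
  shows "card (restrict0 m ` T - degenerate) + 2 \<le> card (T - degenerate)"
proof (rule ccontr)
  assume less: "\<not> ?thesis"
  let ?D = "T - degenerate - {carry (Suc m)}"
  have finD: "finite ?D" using fin by simp
  have "card (T - degenerate) = Suc (card ?D)"
    using c carry_Suc_not_degenerate[OF m] fin by (intro card.remove) auto
  with less have le: "card ?D \<le> card (restrict0 m ` T - degenerate)" by simp
  have "restrict0 m (carry (Suc m)) = (\<lambda>_. False)"
    by (auto simp: restrict0_def carry_Suc)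
  then have "restrict0 m (carry (Suc m)) \<in> degenerate"
    by (simp add: degenerate_def)
  then have sub: "restrict0 m ` T - degenerate \<subseteq> restrict0 m ` ?D"
    using restrict0_degenerate by blast
  have "card (restrict0 m ` T - degenerate) \<le> card (restrict0 m ` ?D)"
    using sub finD by (intro card_mono) auto
  moreover have "card (restrict0 m ` ?D) \<le> card ?D"
    using finD by (rule card_image_le)
  ultimately have eqs: "card (restrict0 m ` ?D) = card ?D"
      "card (restrict0 m ` T - degenerate) = card (restrict0 m ` ?D)"
    using le by auto
  have inj: "inj_on (restrict0 m) ?D"
    using eqs(1) finD by (intro eq_card_imp_inj_on)
  have "restrict0 m ` T - degenerate = restrict0 m ` ?D"
    using sub eqs(2) finD by (intro card_subset_eq) auto
  then have nd: "restrict0 m f \<notin> degenerate" if "f \<in> ?D" for f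
    using that by blast
  \<comment> \<open>This invariant passes through gates. Only a gate with the literal itself as an
    argument could break it, and that case is the preceding lemma.\<close>
  have inv: "f = (\<lambda>a. a m) \<or> (\<forall>a. \<not> carry m a \<longrightarrow> f a = f (a(m := False)))"
    if "f \<in> generated T" for f
    using that
  proof induction
    case (degenerate f)
    then show ?case using degenerate_insensitive[of f m False] by blast
  next
    case (gate f f' h)
    show ?case
    proof (cases "f = (\<lambda>a. a m) \<or> f' = (\<lambda>a. a m)")
      case False
      with gate.IH show ?thesis by (intro disjI2) auto
    next
      case True
      then show ?thesis
      proof
        assume f: "f = (\<lambda>a. a m)"
        show ?thesis
          using gate_on_variable_insensitive[where h = h and f = f', OF inj nd gate.hyps(2,3) _ gate.IH(2)]
            gate.hyps(4)
          unfolding f by blast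
      next
        assume f': "f' = (\<lambda>a. a m)"
        show ?thesis
          using gate_on_variable_insensitive[where h = "\<lambda>p q. h q p" and f = f,
              OF inj nd gate.hyps(1,3) _ gate.IH(1)] gate.hyps(4)
          unfolding f' by blast
      qed
    qed
  qed
  from s gen have "sum_bit m \<in> generated T" by blast
  from inv[OF this] show False
  proof
    assume "sum_bit m = (\<lambda>a. a m)"
    from fun_cong[OF this, of "\<lambda>_. True"] show False
      by (simp add: sum_bit_def carry_def)
  next
    assume *: "\<forall>a. \<not> carry m a \<longrightarrow> sum_bit m a = sum_bit m (a(m := False))"
    \<comment> \<open>With only variable \<open>m\<close> true no carry arrives, as
      \<open>m \<ge> 1\<close>, yet flipping that variable flips \<open>sum_bit m\<close>.\<close>
    have "\<not> carry m (\<lambda>j. j = m)" "\<not> carry m ((\<lambda>j. j = m)(m := False))"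
      using m by (auto simp: carry_def intro!: exI[of _ 0])
    with *[rule_format, of "\<lambda>j. j = m"] show False
      by (simp add: sum_bit_def)
  qed
qed

text \<open>Induction on the number of bits: each restriction of the top variable costs two classes
  and leaves a family for the adder with one bit less.\<close>

lemma card_generating_family:
  assumes "finite T" "T \<subseteq> generated T" "carry (Suc m) \<in> T"
    and "\<And>j. 1 \<le> j \<Longrightarrow> j \<le> m \<Longrightarrow> sum_bit j \<in> T"
  shows "2 * m \<le> card (T - degenerate)"
  using assms
proof (induction m arbitrary: T)
  case 0
  then show ?case by simp
next
  case (Suc m)
  let ?T = "restrict0 (Suc m) ` T"
  have "2 * m \<le> card (?T - degenerate)"
  proof (rule Suc.IH)
    show "finite ?T" using Suc.prems(1) by simp
    show "?T \<subseteq> generated ?T"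
      using Suc.prems(2) generated_restrict0 by blast
    \<comment> \<open>The top carry is destroyed by the restriction; the highest sum bit turns into
      the new top carry.\<close>
    have "carry (Suc m) = restrict0 (Suc m) (sum_bit (Suc m))"
      by (auto simp: restrict0_def sum_bit_def carry_def fun_eq_iff)
    then show "carry (Suc m) \<in> ?T"
      using Suc.prems(4)[of "Suc m"] by simp
  next
    fix j assume j: "1 \<le> j" "j \<le> m"
    then have "sum_bit j = restrict0 (Suc m) (sum_bit j)"
      by (auto simp: restrict0_def sum_bit_def carry_def fun_eq_iff)
    then show "sum_bit j \<in> ?T"
      using Suc.prems(4)[of j] j by simp
  qed
  moreover have "card (?T - degenerate) + 2 \<le> card (T - degenerate)"
    using Suc.prems by (intro card_restrict0) auto
  ultimately show ?case by simp
qed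

section \<open>Functions computed by a circuit\<close>

text \<open>Assignments are total on \<open>nat\<close>, so that fixing a variable does not change
  the type; only the first \<open>k\<close> values are read.\<close>

definition value_at :: "nat \<Rightarrow> circuit \<Rightarrow> nat \<Rightarrow> boolfun" where
  "value_at k C v a = (THE b. node_value C (map a [0..<k]) v b)"

definition normalized_at :: "nat \<Rightarrow> circuit \<Rightarrow> nat \<Rightarrow> boolfun" where
  "normalized_at k C v a \<longleftrightarrow> value_at k C v a \<noteq> value_at k C v (\<lambda>_. False)"

lemma value_at_eq:
  assumes "node_value C (map a [0..<k]) v b"
  shows "value_at k C v a = b"
  unfolding value_at_def by (rule the_equality, rule assms) (rule node_value_unique[OF _ assms])

lemma node_value_value_at:
  assumes "circuit_on k C" "v \<in> nodes C"
  shows "node_value C (map a [0..<k]) v (value_at k C v a)"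
proof -
  obtain b where b: "node_value C (map a [0..<k]) v b"
    using node_value_exists[OF assms] by blast
  with value_at_eq[OF b] show ?thesis by simp
qed

lemma wf_edges: "circuit_on k C \<Longrightarrow> wf (edges C)"
  unfolding circuit_on_def by (meson finite_SigmaI finite_acyclic_wf finite_subset)

lemma normalized_at_source:
  assumes "circuit_on k C" "v \<in> nodes C" "\<nexists>g u w. lab C v = Gate g u w"
  shows "normalized_at k C v \<in> degenerate"
proof (cases "lab C v")
  case (Var i)
  then have "i < k" using assms by (auto simp: circuit_on_def)
  then have "value_at k C v a = a i" for a
    using value_at_eq[OF node_value.intros(1)[OF Var]] by (metis add_0 nth_map_upt diff_zero)
  then have "normalized_at k C v = (\<lambda>a. a i)"
    by (simp add: normalized_at_def fun_eq_iff)
  then show ?thesis by (simp add: degenerate_def)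
next
  case (Const b)
  have "value_at k C v a = b" for a
    by (intro value_at_eq node_value.intros(2) Const)
  then have "normalized_at k C v = (\<lambda>_. False)"
    by (simp add: normalized_at_def fun_eq_iff)
  then show ?thesis by (simp add: degenerate_def)
next
  case Gate
  then show ?thesis using assms(3) by simp
qed

lemma normalized_at_generated:
  assumes C: "circuit_on k C"
  shows "v \<in> nodes C \<Longrightarrow> normalized_at k C v \<in> generated (normalized_at k C ` nodes C)"
proof (induction v rule: wf_induct_rule[OF wf_edges[OF C]])
  case (1 v)
  show ?case
  proof (cases "\<exists>g u w. lab C v = Gate g u w")
    case False
    then show ?thesis
      using normalized_at_source[OF C 1(2)] by (intro generated.degenerate) simp
  next
    case True
    then obtain g u w where l: "lab C v = Gate g u w" by blast
    then have e: "(u, v) \<in> edges C" "(w, v) \<in> edges C"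
      using 1(2) by (auto simp: edges_def)
    then have n: "u \<in> nodes C" "w \<in> nodes C"
      using C by (auto simp: circuit_on_def)
    let ?z = "\<lambda>_. False"
    \<comment> \<open>Normalizing a node amounts to complementing its function or not, so
      \<open>h\<close> is \<open>g\<close> with these complements absorbed at both arguments and at
      the result.\<close>
    define h where "h p q \<longleftrightarrow>
      g (p \<noteq> value_at k C u ?z) (q \<noteq> value_at k C w ?z) \<noteq> value_at k C v ?z" for p q
    have val: "value_at k C v a = g (value_at k C u a) (value_at k C w a)" for a
      using n by (intro value_at_eq node_value.intros(3)[OF l] node_value_value_at[OF C])
    have xor: "((p \<noteq> q) \<noteq> q) = p" for p q :: bool by auto
    have eq: "normalized_at k C v = (\<lambda>a. h (normalized_at k C u a) (normalized_at k C w a))"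
      unfolding normalized_at_def h_def xor val[symmetric] by simp
    have h0: "h False False = False"
      unfolding h_def by (simp add: val)
    have "normalized_at k C v \<in> normalized_at k C ` nodes C"
      using 1(2) by (rule imageI)
    then show ?thesis
      unfolding eq by (rule generated.gate[where h = h, OF 1(1)[OF e(1) n(1)] 1(1)[OF e(2) n(2)] h0])
  qed
qed

text \<open>Source nodes give degenerate functions, so every remaining class comes from at least one
  gate.\<close>

lemma card_normalized_le_gate_count:
  assumes C: "circuit_on k C"
  shows "card (normalized_at k C ` nodes C - degenerate) \<le> gate_count C"
proof -
  let ?G = "{v \<in> nodes C. \<exists>g a b. lab C v = Gate g a b}"
  have fin: "finite ?G" using C by (simp add: circuit_on_def)
  have "normalized_at k C ` nodes C - degenerate \<subseteq> normalized_at k C ` ?G"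
    using normalized_at_source[OF C] by blast
  then have "card (normalized_at k C ` nodes C - degenerate) \<le> card (normalized_at k C ` ?G)"
    using fin by (intro card_mono) auto
  also have "\<dots> \<le> card ?G" using fin by (rule card_image_le)
  finally show ?thesis by (simp add: gate_count_def)
qed

section \<open>The bits of the sum\<close>

lemma weighted_sum_increment:
  "weighted_sum (0 # [0..<n]) (map a [0..<n + 1]) =
     of_bool (a 0) + (\<Sum>i<n. 2 ^ i * of_bool (a (Suc i)))"
proof -
  have "weighted_sum (0 # [0..<n]) (map a [0..<n + 1]) =
      (\<Sum>i<Suc n. 2 ^ ((0 # [0..<n]) ! i) * of_bool (map a [0..<n + 1] ! i))"
    by (simp add: weighted_sum_def)
  also have "\<dots> = of_bool (a 0) + (\<Sum>i<n. 2 ^ i * of_bool (a (Suc i)))"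
    unfolding sum.lessThan_Suc_shift by (simp del: upt_Suc)
  finally show ?thesis .
qed

text \<open>This is the invariant of ripple-carry addition. Position \<open>i\<close> belongs to
  variable \<open>Suc i\<close>, whence the shift in \<open>sum_bit\<close>.\<close>

lemma sum_ripple_carry:
  "of_bool (a 0) + (\<Sum>i<n. 2 ^ i * of_bool (a (Suc i))) =
     (\<Sum>i<n. 2 ^ i * of_bool (sum_bit (Suc i) a)) + (2 ^ n * of_bool (carry (Suc n) a) :: nat)"
proof (induction n)
  case 0
  then show ?case by (simp add: carry_def)
next
  case (Suc n)
  then show ?case
    by (cases "carry (Suc n) a"; cases "a (Suc n)")
       (simp_all add: sum_bit_def carry_Suc[of "Suc n"])
qed

lemma bit_weighted_sum:
  "bit (weighted_sum (0 # [0..<n]) (map a [0..<n + 1])) j \<longleftrightarrow>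
     j < n \<and> sum_bit (Suc j) a \<or> j = n \<and> carry (Suc n) a"
proof -
  let ?bs = "map (\<lambda>i. sum_bit (Suc i) a) [0..<n] @ [carry (Suc n) a]"
  \<comment> \<open>The ripple-carry identity is a binary expansion with digits \<open>?bs\<close>,
    from which the bits can be read off.\<close>
  have "weighted_sum (0 # [0..<n]) (map a [0..<n + 1]) = horner_sum of_bool 2 ?bs"
    unfolding weighted_sum_increment sum_ripple_carry horner_sum_eq_sum
    by (simp add: nth_append mult.commute atLeast0LessThan)
  then show ?thesis
    by (auto simp: bit_horner_sum_bit_iff nth_append less_Suc_eq)
qed

text \<open>No position up to \<open>n\<close> is identically zero, so the bit adder omits none: a
  single true variable \<open>Suc j\<close> sets bit \<open>j < n\<close>, and the all-true input
  sets bit \<open>n\<close>.\<close>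

lemma bit_positions_increment: "bit_positions (0 # [0..<n]) = {..n}"
proof (intro equalityI subsetI)
  fix j assume "j \<in> bit_positions (0 # [0..<n])"
  then obtain x where x: "length x = n + 1" "bit (weighted_sum (0 # [0..<n]) x) j"
    by (auto simp: bit_positions_def)
  moreover from x(1) have "x = map (nth x) [0..<n + 1]"
    by (metis map_nth)
  ultimately show "j \<in> {..n}" using bit_weighted_sum[of n "nth x" j] by auto
next
  fix j assume "j \<in> {..n}"
  then consider "j < n" | "j = n" by force
  then have "\<exists>a. bit (weighted_sum (0 # [0..<n]) (map a [0..<n + 1])) j"
  proof cases
    case 1
    then have "sum_bit (Suc j) (\<lambda>i. i = Suc j)" by (auto simp: sum_bit_def carry_def)
    then show ?thesis unfolding bit_weighted_sum using 1 by blast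
  next
    case 2
    have "carry (Suc n) (\<lambda>_. True)" by (simp add: carry_def)
    then show ?thesis unfolding bit_weighted_sum using 2 by blast
  qed
  then obtain a where a: "bit (weighted_sum (0 # [0..<n]) (map a [0..<n + 1])) j" ..
  show "j \<in> bit_positions (0 # [0..<n])"
    unfolding bit_positions_def using a by (intro CollectI exI[of _ "map a [0..<n + 1]"]) simp
qed

lemma bit_adder_increment:
  "bit_adder (0 # [0..<n]) (map a [0..<n + 1]) =
     map (\<lambda>j. sum_bit (Suc j) a) [0..<n] @ [carry (Suc n) a]"
proof -
  have "sorted_list_of_set {..n} = [0..<n] @ [n]"
    using sorted_list_of_set_range[of 0 "Suc n"] by (simp flip: lessThan_Suc_atMost add: atLeast0LessThan)
  then show ?thesis
    unfolding bit_adder_def bit_positions_increment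
    by (simp add: bit_weighted_sum[unfolded Suc_eq_plus1[symmetric]] del: upt_Suc)
qed

lemma gate_count_increment:
  assumes C: "circuit_on (n + 1) C" and comp: "computes (n + 1) C (bit_adder (0 # [0..<n]))"
  shows "2 * n \<le> gate_count C"
proof -
  let ?T = "normalized_at (n + 1) C ` nodes C"
  have outs: "list_all2 (node_value C (map a [0..<n + 1])) (outs C)
      (map (\<lambda>j. sum_bit (Suc j) a) [0..<n] @ [carry (Suc n) a])" for a
  proof -
    have "length (map a [0..<n + 1]) = n + 1" by simp
    with comp show ?thesis unfolding computes_def bit_adder_increment[symmetric] by blast
  qed
  have len: "length (outs C) = Suc n"
    using list_all2_lengthD[OF outs] by simp
  \<comment> \<open>An output function that vanishes at the all-\<open>False\<close> assignment is
    its own normalized representative, so it lies in \<open>?T\<close> unchanged.\<close>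
  have mem: "f \<in> ?T"
    if i: "i \<le> n" and f: "\<And>a. (map (\<lambda>j. sum_bit (Suc j) a) [0..<n] @ [carry (Suc n) a]) ! i = f a"
      and f0: "\<not> f (\<lambda>_. False)" for f :: boolfun and i
  proof -
    have "node_value C (map a [0..<n + 1]) (outs C ! i) (f a)" for a
    proof -
      from i len have "i < length (outs C)" by simp
      from list_all2_nthD[OF outs this, of a] show ?thesis unfolding f .
    qed
    then have "value_at (n + 1) C (outs C ! i) a = f a" for a
      by (rule value_at_eq)
    then have "f = normalized_at (n + 1) C (outs C ! i)"
      using f0 by (simp add: normalized_at_def fun_eq_iff)
    moreover have "outs C ! i \<in> nodes C"
      using C i len by (auto simp: circuit_on_def subset_iff)
    ultimately show ?thesis by blast
  qed
  have "2 * n \<le> card (?T - degenerate)"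
  proof (rule card_generating_family)
    show "finite ?T" using C by (simp add: circuit_on_def)
    show "?T \<subseteq> generated ?T" using normalized_at_generated[OF C] by blast
    show "carry (Suc n) \<in> ?T"
      by (rule mem[of n]) (auto simp: nth_append carry_def)
    show "sum_bit j \<in> ?T" if "1 \<le> j" "j \<le> n" for j
      using that by (intro mem[of "j - 1"]) (auto simp: nth_append sum_bit_def carry_def intro!: exI[of _ 0])
  qed
  also have "\<dots> \<le> gate_count C" by (rule card_normalized_le_gate_count[OF C])
  finally show ?thesis .
qed

section \<open>The ripple-carry circuit\<close>

text \<open>
  The lower bound on the \<open>LEAST\<close> size needs some circuit to exist. Node \<open>3m\<close> is the
  input \<open>m\<close>, node \<open>3m + 1\<close> computes \<open>carry (Suc m)\<close> and node \<open>3m + 2\<close> computes \<open>sum_bit m\<close>;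
  node \<open>2\<close> is a dummy.
\<close>

definition ripple_lab :: "nat \<Rightarrow> node_label" where
  "ripple_lab v =
     (if v mod 3 = 0 then Var (v div 3)
      else if v < 3 then Gate (\<and>) 0 0
      else Gate (if v mod 3 = 1 then (\<and>) else (\<noteq>)) (3 * (v div 3) - 2) (3 * (v div 3)))"

definition ripple_circuit :: "nat \<Rightarrow> circuit" where
  "ripple_circuit n = \<lparr>nodes = {..<3 * Suc n}, lab = ripple_lab,
     outs = map (\<lambda>j. 3 * Suc j + 2) [0..<n] @ [3 * n + 1]\<rparr>"

text \<open>A gate \<open>v\<close> is not divisible by 3 and reads nodes up to
  \<open>3 * (v div 3)\<close>, so all edges lead to larger numbers.\<close>

lemma ripple_circuit_on: "circuit_on (n + 1) (ripple_circuit n)"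
proof -
  have less: "u < v" if "(u, v) \<in> edges (ripple_circuit n)" for u v
  proof -
    from that obtain g a b where "ripple_lab v = Gate g a b" "u = a \<or> u = b"
      by (auto simp: edges_def ripple_circuit_def)
    then have "v mod 3 \<noteq> 0" "u \<le> 3 * (v div 3)"
      by (auto simp: ripple_lab_def split: if_splits)
    with mult_div_mod_eq[of 3 v] show "u < v" by linarith
  qed
  then have "edges (ripple_circuit n) \<subseteq> less_than" by auto
  then have "acyclic (edges (ripple_circuit n))"
    using wf_acyclic[OF wf_less_than] acyclic_subset by blast
  moreover have "edges (ripple_circuit n) \<subseteq> nodes (ripple_circuit n) \<times> nodes (ripple_circuit n)"
  proof clarify
    fix u v assume e: "(u, v) \<in> edges (ripple_circuit n)"
    then have "v \<in> nodes (ripple_circuit n)" by (simp add: edges_def)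
    with less[OF e] show "u \<in> nodes (ripple_circuit n) \<and> v \<in> nodes (ripple_circuit n)"
      by (simp add: ripple_circuit_def)
  qed
  ultimately show ?thesis
    unfolding circuit_on_def by (auto simp: ripple_circuit_def ripple_lab_def split: if_splits)
qed

lemma ripple_lab_simps:
  "ripple_lab (3 * m) = Var m"
  "ripple_lab (Suc 0) = Gate (\<and>) 0 0"
  "ripple_lab (3 * Suc m + 1) = Gate (\<and>) (3 * m + 1) (3 * Suc m)"
  "ripple_lab (3 * Suc m + 2) = Gate (\<noteq>) (3 * m + 1) (3 * Suc m)"
proof -
  have "(3 * Suc m + 1) div 3 = Suc m" "(3 * Suc m + 1) mod 3 = 1"
    "(3 * Suc m + 2) div 3 = Suc m" "(3 * Suc m + 2) mod 3 = 2"
    by presburger+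
  then show "ripple_lab (3 * m) = Var m"
    "ripple_lab (Suc 0) = Gate (\<and>) 0 0"
    "ripple_lab (3 * Suc m + 1) = Gate (\<and>) (3 * m + 1) (3 * Suc m)"
    "ripple_lab (3 * Suc m + 2) = Gate (\<noteq>) (3 * m + 1) (3 * Suc m)"
    unfolding ripple_lab_def by simp_all
qed

lemma ripple_circuit_computes:
  "computes (n + 1) (ripple_circuit n) (bit_adder (0 # [0..<n]))"
  unfolding computes_def
proof (intro allI impI)
  fix x :: "bool list" assume "length x = n + 1"
  then have x: "x = map (nth x) [0..<n + 1]" by (metis map_nth)
  let ?V = "node_value (ripple_circuit n) x"
  have lab: "lab (ripple_circuit n) = ripple_lab" by (simp add: ripple_circuit_def)
  have var: "?V (3 * m) (x ! m)" for m
    by (rule node_value.intros(1)) (simp add: lab ripple_lab_simps)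
  have car: "?V (3 * m + 1) (carry (Suc m) (nth x))" for m
  proof (induction m)
    case 0
    \<comment> \<open>The first carry is input \<open>0\<close> itself, obtained as its conjunction
      with itself.\<close>
    have "?V 1 (x ! 0 \<and> x ! 0)"
      using var[of 0] by (intro node_value.intros(3)[of _ _ "(\<and>)" 0 0]) (simp_all add: lab ripple_lab_simps)
    then show ?case by (simp add: carry_def)
  next
    case (Suc m)
    have "?V (3 * Suc m + 1) (carry (Suc m) (nth x) \<and> x ! Suc m)"
      by (rule node_value.intros(3)[OF _ Suc var]) (simp only: lab ripple_lab_simps)
    then show ?case by (simp only: carry_Suc[of "Suc m"])
  qed
  have "?V (3 * Suc j + 2) (carry (Suc j) (nth x) \<noteq> x ! Suc j)" for j
    by (rule node_value.intros(3)[OF _ car var]) (simp only: lab ripple_lab_simps)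
  moreover have "sum_bit (Suc j) (nth x) = (carry (Suc j) (nth x) \<noteq> x ! Suc j)" for j
    unfolding sum_bit_def by blast
  ultimately have sum: "?V (3 * Suc j + 2) (sum_bit (Suc j) (nth x))" for j
    by simp
  have "list_all2 ?V (map (\<lambda>j. 3 * Suc j + 2) [0..<n])
      (map (\<lambda>j. sum_bit (Suc j) (nth x)) [0..<n])"
    unfolding list_all2_map1 list_all2_map2 by (rule list.rel_refl, rule sum)
  moreover have "list_all2 ?V [3 * n + 1] [carry (Suc n) (nth x)]"
    using car[of n] by (simp only: list_all2_Cons list_all2_Nil simp_thms)
  ultimately have "list_all2 ?V (outs (ripple_circuit n))
      (map (\<lambda>j. sum_bit (Suc j) (nth x)) [0..<n] @ [carry (Suc n) (nth x)])"
    unfolding ripple_circuit_def circuit.simps by (rule list_all2_appendI)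
  then show "list_all2 ?V (outs (ripple_circuit n)) (bit_adder (0 # [0..<n]) x)"
    unfolding bit_adder_increment[of n "nth x", folded x] .
qed

theorem theorem2:
  "\<exists>c::real. \<forall>n::nat. real (circuit_size (n + 1) (bit_adder (0 # [0..<n]))) \<ge> 2 * real n - c"
proof (intro exI allI)
  fix n :: nat
  let ?P = "\<lambda>m. \<exists>C. circuit_on (n + 1) C \<and> computes (n + 1) C (bit_adder (0 # [0..<n])) \<and>
    gate_count C = m"
  have "?P (circuit_size (n + 1) (bit_adder (0 # [0..<n])))"
    unfolding circuit_size_def
    by (rule LeastI_ex) (use ripple_circuit_on ripple_circuit_computes in blast)
  then obtain C where C: "circuit_on (n + 1) C" "computes (n + 1) C (bit_adder (0 # [0..<n]))"
    and size: "gate_count C = circuit_size (n + 1) (bit_adder (0 # [0..<n]))"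
    by blast
  have "2 * n \<le> circuit_size (n + 1) (bit_adder (0 # [0..<n]))"
    using gate_count_increment[OF C] unfolding size .
  \<comment> \<open>The constant can be taken to be \<open>0\<close>.\<close>
  then show "2 * real n - 0 \<le> real (circuit_size (n + 1) (bit_adder (0 # [0..<n])))"
    by linarith
qed

end
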